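(* Let $n$ and $r$ be positive integers. Then $$\frac{\zeta(2n+1)}{r^{2n}}=(-1)^{n+1}\int_{[0,1]^n}\left(\prod_{i=1}^{n}\frac{\log(x_i)}{x_i}\right)\log\left(1-\left(\prod_{i=1}^n x_i\right)^r\right)\,dx_1\cdots dx_n .$$
   Context: $\zeta$ denotes the Riemann zeta function, and $\log$ is the natural logarithm. The integrand is defined on the open hypercube $]0,1[^n$, and the integral over $[0,1]^n$ is understood as a generalized (improper) integral. *)

theory Defs
  imports "HOL-Analysis.Analysis"
begin

(* Riemann's zeta function on the half-line s > 1, where its Dirichlet series converges;
   for s \<le> 1 the value is unspecified and must not be used. *)
definition riemann_zeta :: "real \<Rightarrow> real" where
  "riemann_zeta s = (\<Sum>k. 1 / real (Suc k) powr s)"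

(* Points of R^n are extensional functions on {1..n}, and n-dimensional Lebesgue measure is the
   product of n copies of lborel. *)
abbreviation lborel_dim :: "nat \<Rightarrow> (nat \<Rightarrow> real) measure" where
  "lborel_dim n \<equiv> Pi\<^sub>M {1..n} (\<lambda>_. lborel)"

definition open_cube :: "nat \<Rightarrow> (nat \<Rightarrow> real) set" where
  "open_cube n = Pi\<^sub>E {1..n} (\<lambda>_. {0<..<1})"

definition zeta_integrand :: "nat \<Rightarrow> nat \<Rightarrow> (nat \<Rightarrow> real) \<Rightarrow> real" where
  "zeta_integrand n r x =
     (\<Prod>i=1..n. ln (x i) / x i) * ln (1 - (\<Prod>i=1..n. x i) ^ r)"

end

theory Submission
  imports Defs "HOL-Real_Asymp.Real_Asymp"
begin

text \<open>
  Expand the logarithm: writing \<open>P\<close> for the product of the coordinates, on the open cube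
  \<open>ln (1 - P ^ r) = - (\<Sum>k. P ^ (r * (k + 1)) / (k + 1))\<close>.  Multiplying by the remaining factors
  \<open>ln (x i) / x i\<close> turns each summand into a product of functions of a single coordinate, so by
  Fubini its integral is a power of the one-dimensional integral of \<open>ln t * t ^ (a - 1)\<close> over the
  unit interval with \<open>a = r * (k + 1)\<close>, which is \<open>- 1 / a\<^sup>2\<close>
  (\<open>has_bochner_integral_log_moment\<close>).  Hence the term of index \<open>k\<close> contributes, up to the sign
  \<open>(- 1) ^ (n + 1)\<close>, the number \<open>1 / ((k + 1) ^ (2 * n + 1) * r ^ (2 * n))\<close>, and summation gives
  the zeta value.

  The exchange of sum and integral, and with it the absolute convergence of the integral, comes
  for free from signs: on the cube every logarithm is negative, so all the terms have the same sign
  (\<open>norm_zeta_term\<close>).  The integrals of their absolute values are therefore the terms of the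
  convergent zeta series itself.
\<close>

text \<open>
  The indicator is part of the function so that products over the coordinates vanish outside the
  cube and Fubini applies to them on the whole space.
\<close>
definition log_moment :: "nat \<Rightarrow> real \<Rightarrow> real" where
  "log_moment a t = indicator {0<..<1} t * (ln t * t ^ (a - 1))"

lemma log_moment_nonpos: "log_moment a t \<le> 0"
  by (auto simp: log_moment_def indicator_def intro!: mult_nonpos_nonneg)

text \<open>
  The primitive \<open>F\<close> of \<open>- ln t * t ^ (a - 1)\<close> found by parts tends to \<open>0\<close> at \<open>0\<close>; as the integrand
  has constant sign, the fundamental theorem applies despite the singularity at \<open>0\<close> and yields
  integrability at the same time.
\<close>
lemma has_bochner_integral_log_moment:
  assumes "a > 0"
  shows "has_bochner_integral lborel (log_moment a) (- (1 / real a ^ 2))"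
proof -
  define F where "F = (\<lambda>t::real. t ^ a / real a ^ 2 - t ^ a * ln t / real a)"
  define f where "f = (\<lambda>t::real. - (ln t * t ^ (a - 1)))"
  obtain b where b: "a = Suc b"
    using assms gr0_implies_Suc by blast
  have deriv: "(F has_real_derivative f t) (at t)" if "0 < t" for t
  proof -
    have pow_a: "t ^ a = t * t ^ b" and b1: "a - 1 = b"
      using b by simp_all
    have pow: "((\<lambda>t. t ^ a) has_real_derivative real a * t ^ b) (at t)"
      using DERIV_pow[of a t] b by simp
    show ?thesis
      unfolding F_def
      by (rule DERIV_cong[OF DERIV_diff[OF DERIV_cdivide[OF pow]
            DERIV_cdivide[OF DERIV_mult[OF pow DERIV_ln[OF that]]]]])
         (use that assms pow_a b1 in \<open>simp add: f_def field_simps power2_eq_square\<close>)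
  qed
  have lim0: "(F \<longlongrightarrow> 0) (at_right 0)"
    unfolding F_def using assms by real_asymp
  have "(F \<longlongrightarrow> F 1) (at_left 1)"
    using deriv[of 1] by (intro tendsto_intros DERIV_isCont isContD[THEN tendsto_within_subset]) auto
  then have lim1: "(F \<longlongrightarrow> 1 / real a ^ 2) (at_left 1)"
    by (simp add: F_def)
  have cont: "isCont f t" if "0 < t" for t
    unfolding f_def using that by (intro continuous_intros) auto
  have nn: "0 \<le> f t" if "0 < t" "t < 1" for t
    using that by (auto simp: f_def intro!: mult_nonpos_nonneg)
  have lims: "((F \<circ> real_of_ereal) \<longlongrightarrow> 0) (at_right (0::ereal))"
       "((F \<circ> real_of_ereal) \<longlongrightarrow> 1 / real a ^ 2) (at_left (1::ereal))"
    using lim0 lim1 ereal_tendsto_simps1(1,2)[of F _ 0] ereal_tendsto_simps1(1,2)[of F _ 1]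
    by (simp_all add: zero_ereal_def one_ereal_def)
  have int: "set_integrable lborel (einterval 0 1) f"
       "(LBINT t=(0::ereal)..1. f t) = 1 / real a ^ 2"
    using interval_integral_FTC_nonneg[OF _ _ _ _ lims, of f] deriv cont nn by auto
  have ei: "einterval 0 1 = {0<..<1}"
    by (auto simp: einterval_def)
  have eq: "log_moment a t = - (indicator {0<..<1} t *\<^sub>R f t)" for t
    by (auto simp: log_moment_def f_def)
  have "has_bochner_integral lborel (\<lambda>t. indicator {0<..<1} t *\<^sub>R f t) (1 / real a ^ 2)"
    using int unfolding has_bochner_integral_iff ei set_integrable_def
    by (simp add: interval_lebesgue_integral_def set_lebesgue_integral_def ei)
  then show ?thesis
    unfolding eq by (rule has_bochner_integral_minus)
qed

lemma has_bochner_integral_prod_log_moment: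
  assumes "a > 0"
  shows "has_bochner_integral (lborel_dim n) (\<lambda>x. \<Prod>i=1..n. log_moment a (x i))
           ((- 1) ^ n / real a ^ (2 * n))"
proof -
  interpret product_sigma_finite "\<lambda>_::nat. lborel :: real measure" ..
  have moment: "integrable lborel (log_moment a)" "integral\<^sup>L lborel (log_moment a) = - (1 / real a ^ 2)"
    using has_bochner_integral_log_moment[OF assms] by (auto simp: has_bochner_integral_iff)
  have "(\<Prod>i=1..n. integral\<^sup>L lborel (log_moment a)) = (- 1) ^ n / real a ^ (2 * n)"
    by (simp add: moment(2) power_mult power_divide flip: minus_divide_left minus_divide_right)
       (simp add: power_minus[of "1 / _"] power_divide)
  with moment(1) show ?thesis
    unfolding has_bochner_integral_iff
    by (subst product_integral_prod) (auto intro!: product_integrable_prod)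
qed

lemma ln_one_minus_sums:
  fixes q :: real
  assumes "\<bar>q\<bar> < 1"
  shows "(\<lambda>k. - (q ^ Suc k / real (Suc k))) sums ln (1 - q)"
  using ln_series'[of "- q"] assms by (subst sums_Suc_iff) simp

text \<open>
  The term of index \<open>k\<close> in the logarithmic expansion of the integrand, extended by \<open>0\<close> outside
  the cube; the form with separated coordinates is the one that Fubini needs.
\<close>
definition zeta_term :: "nat \<Rightarrow> nat \<Rightarrow> nat \<Rightarrow> (nat \<Rightarrow> real) \<Rightarrow> real" where
  "zeta_term n r k x = - (1 / real (Suc k)) * (\<Prod>i=1..n. log_moment (r * Suc k) (x i))"

text \<open>
  Positivity of \<open>n\<close> matters: the empty product is \<open>1\<close>, where the logarithmic series diverges.
\<close>
lemma prod_open_cube: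
  assumes "x \<in> open_cube n" "n > 0"
  shows "0 < (\<Prod>i=1..n. x i)" "(\<Prod>i=1..n. x i) < 1"
proof -
  have x: "0 < x i \<and> x i < 1" if "i \<in> {1..n}" for i
    using assms that by (auto simp: open_cube_def PiE_iff)
  show "0 < (\<Prod>i=1..n. x i)"
    using x by (intro prod_pos) auto
  have "(\<Prod>i=1..n. x i) < (\<Prod>i=1..n. 1)"
    using x assms(2) by (intro prod_mono_strict[where i=1]) (auto intro: less_imp_le)
  then show "(\<Prod>i=1..n. x i) < 1"
    by simp
qed

lemma zeta_term_on_cube:
  assumes "x \<in> open_cube n" "r > 0"
  shows "zeta_term n r k x =
    (\<Prod>i=1..n. ln (x i) / x i) * (- (((\<Prod>i=1..n. x i) ^ r) ^ Suc k / real (Suc k)))"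
proof -
  have x: "0 < x i \<and> x i < 1" if "i \<in> {1..n}" for i
    using assms that by (auto simp: open_cube_def PiE_iff)
  have "log_moment (r * Suc k) (x i) = ln (x i) / x i * (x i) ^ (r * Suc k)" if "i \<in> {1..n}" for i
    using x[OF that] assms(2) by (simp add: log_moment_def power_diff del: mult_Suc_right)
  then have "(\<Prod>i=1..n. log_moment (r * Suc k) (x i)) =
      (\<Prod>i=1..n. ln (x i) / x i) * (\<Prod>i=1..n. x i) ^ (r * Suc k)"
    unfolding prod_power_distrib prod.distrib[symmetric] by (rule prod.cong[OF refl])
  then show ?thesis
    by (simp add: zeta_term_def power_mult del: power_Suc mult_Suc_right)
qed

lemma zeta_term_outside_cube:
  assumes "x \<in> space (lborel_dim n)" "x \<notin> open_cube n"
  shows "zeta_term n r k x = 0"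
proof -
  obtain i where "i \<in> {1..n}" "x i \<notin> {0<..<1}"
    using assms by (auto simp: open_cube_def space_PiM PiE_iff)
  then have "(\<Prod>i=1..n. log_moment (r * Suc k) (x i)) = 0"
    by (intro prod_zero bexI[of _ i]) (auto simp: log_moment_def indicator_def)
  then show ?thesis
    by (simp add: zeta_term_def)
qed

lemma zeta_term_sums:
  assumes "n > 0" "r > 0" "x \<in> space (lborel_dim n)"
  shows "(\<lambda>k. zeta_term n r k x) sums (indicator (open_cube n) x *\<^sub>R zeta_integrand n r x)"
proof (cases "x \<in> open_cube n")
  case True
  let ?q = "(\<Prod>i=1..n. x i) ^ r"
  have "\<bar>?q\<bar> < 1"
    using prod_open_cube[OF True assms(1)] assms(2) by (simp add: power_less_one_iff)
  then have "(\<lambda>k. (\<Prod>i=1..n. ln (x i) / x i) * (- (?q ^ Suc k / real (Suc k)))) sums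
      zeta_integrand n r x"
    unfolding zeta_integrand_def by (intro sums_mult ln_one_minus_sums)
  then show ?thesis
    using True assms(2) by (simp add: zeta_term_on_cube)
qed (use assms zeta_term_outside_cube in simp)

text \<open>
  Each of the \<open>n\<close> factors is nonpositive, as is the coefficient \<open>- 1 / (k + 1)\<close>, so the sign does not
  depend on \<open>k\<close> or on the point.
\<close>
lemma norm_zeta_term:
  "norm (zeta_term n r k x) = (- 1) ^ (n + 1) * zeta_term n r k x"
proof -
  have "(\<Prod>i=1..n. \<bar>log_moment (r * Suc k) (x i)\<bar>) = (\<Prod>i=1..n. - log_moment (r * Suc k) (x i))"
    by (intro prod.cong refl abs_of_nonpos log_moment_nonpos)
  also have "\<dots> = (- 1) ^ n * (\<Prod>i=1..n. log_moment (r * Suc k) (x i))"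
    by (simp add: prod_uminus)
  finally show ?thesis
    by (simp add: zeta_term_def abs_mult abs_prod)
qed

lemma has_bochner_integral_zeta_term:
  assumes "r > 0"
  shows "has_bochner_integral (lborel_dim n) (zeta_term n r k)
    ((- 1) ^ (n + 1) * (1 / real (Suc k) ^ (2 * n + 1) / real r ^ (2 * n)))"
proof -
  have "has_bochner_integral (lborel_dim n) (zeta_term n r k)
     (- (1 / real (Suc k)) * ((- 1) ^ n / real (r * Suc k) ^ (2 * n)))"
    unfolding zeta_term_def
    using assms by (intro has_bochner_integral_mult_right has_bochner_integral_prod_log_moment) auto
  also have "- (1 / real (Suc k)) * ((- 1) ^ n / real (r * Suc k) ^ (2 * n)) =
      (- 1) ^ (n + 1) * (1 / real (Suc k) ^ (2 * n + 1) / real r ^ (2 * n))"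
    by (simp add: power_mult_distrib mult_ac del: mult_Suc_right of_nat_Suc)
  finally show ?thesis .
qed

lemma riemann_zeta_nat_sums:
  assumes "m > 1"
  shows "(\<lambda>k. 1 / real (Suc k) ^ m) sums riemann_zeta (real m)"
proof -
  have "summable (\<lambda>k. 1 / real (Suc k) ^ m)"
    using inverse_power_summable[of m, where 'a=real] assms
    by (subst summable_Suc_iff) (simp add: field_simps)
  then show ?thesis
    by (simp add: riemann_zeta_def powr_realpow sums_iff del: of_nat_Suc)
qed

theorem corollary2p3:
  fixes n r :: nat
  assumes "n > 0" and "r > 0"
  shows "set_integrable (lborel_dim n) (open_cube n) (zeta_integrand n r) \<and>
    riemann_zeta (real (2 * n + 1)) / real r ^ (2 * n) =
      (- 1) ^ (n + 1) * (LINT x:open_cube n|lborel_dim n. zeta_integrand n r x)"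
proof -
  let ?M = "lborel_dim n"
  let ?Z = "riemann_zeta (real (2 * n + 1)) / real r ^ (2 * n)"
  let ?h = "\<lambda>x. indicator (open_cube n) x *\<^sub>R zeta_integrand n r x"
  \<comment> \<open>The integrals of the norms are again the terms of the zeta series, which justifies integrating
     the expansion term by term.\<close>
  note zterm = has_bochner_integral_zeta_term[OF assms(2), of n]
  have int: "integrable ?M (zeta_term n r k)" for k
    using zterm by (auto simp: has_bochner_integral_iff)
  have zeta: "(\<lambda>k. 1 / real (Suc k) ^ (2 * n + 1) / real r ^ (2 * n)) sums ?Z"
    using assms by (intro sums_divide riemann_zeta_nat_sums) auto
  have norm_int: "(\<integral>x. norm (zeta_term n r k x) \<partial>?M) =
      1 / real (Suc k) ^ (2 * n + 1) / real r ^ (2 * n)" for k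
    using zterm[of k] unfolding norm_zeta_term has_bochner_integral_iff
    by (simp add: del: of_nat_Suc flip: power_add)
  have norms: "AE x in ?M. summable (\<lambda>k. norm (zeta_term n r k x))"
    unfolding norm_zeta_term using zeta_term_sums[OF assms]
    by (intro AE_I2 summable_mult) (auto simp: sums_iff)
  have norm_ints: "summable (\<lambda>k. \<integral>x. norm (zeta_term n r k x) \<partial>?M)"
    unfolding norm_int using zeta by (simp add: sums_iff)
  have suminf: "(\<Sum>k. zeta_term n r k x) = ?h x" if "x \<in> space ?M" for x
    using zeta_term_sums[OF assms that] by (simp add: sums_iff)
  have "integrable ?M (\<lambda>x. \<Sum>k. zeta_term n r k x)"
    by (rule integrable_suminf[OF int norms norm_ints])
  then have h_int: "integrable ?M ?h"
    by (rule Bochner_Integration.integrable_cong[THEN iffD1, rotated -1]) (simp_all add: suminf)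
  have "(\<lambda>k. integral\<^sup>L ?M (zeta_term n r k)) sums (\<integral>x. (\<Sum>k. zeta_term n r k x) \<partial>?M)"
    by (rule sums_integral[OF int norms norm_ints])
  also have "(\<integral>x. (\<Sum>k. zeta_term n r k x) \<partial>?M) = integral\<^sup>L ?M ?h"
    by (intro Bochner_Integration.integral_cong) (simp_all add: suminf)
  finally have "(\<lambda>k. (- 1) ^ (n + 1) * (1 / real (Suc k) ^ (2 * n + 1) / real r ^ (2 * n)))
      sums integral\<^sup>L ?M ?h"
    using zterm unfolding has_bochner_integral_iff by simp
  then have "integral\<^sup>L ?M ?h = (- 1) ^ (n + 1) * ?Z"
    using sums_mult[OF zeta, of "(- 1) ^ (n + 1)"] sums_unique2 by blast
  with h_int show ?thesis
    unfolding set_integrable_def set_lebesgue_integral_def by (simp flip: power_add)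
qed

end
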